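(* Let $0\le n<m$ be integers. The lifting matrix $\mathbf T_{n,m}$ of the Bernstein polynomial basis is an upper triangular matrix (of size $(n+1)\times(m+1)$) with entries $$\mathbf T_{n,m}[i,j]=\begin{cases}\dfrac{\binom{n}{i-1}\binom{m-n}{j-i}}{\binom{m}{j-1}},& i\le j,\\[2mm] 0,&\text{elsewhere},\end{cases}$$ for $1\le i\le n+1$, $1\le j\le m+1$.
   Context: For $N\ge0$, let $\mathbf T_{N,N+1}$ be the $(N+1)\times(N+2)$ matrix with $\mathbf T_{N,N+1}[i,j]=\frac{N+2-i}{N+1}$ if $i=j$, $\mathbf T_{N,N+1}[i,j]=\frac{i}{N+1}$ if $i=j-1$, and $0$ elsewhere. It satisfies $\mathbf b_N(x)=\mathbf T_{N,N+1}\mathbf b_{N+1}(x)$, where $\mathbf b_N(x)=[b_{0,N}(x),\dots,b_{N,N}(x)]^T$ and $b_{j,N}(x)=\binom Nj\frac{(x-a)^j(b-x)^{N-j}}{(b-a)^N}$ are the Bernstein polynomials on $[a,b]$. For $n<m$ the lifting matrix is defined by $\mathbf T_{n,m}=\mathbf T_{n,n+1}\mathbf T_{n+1,n+2}\cdots\mathbf T_{m-1,m}$. Convention: $\binom{r}{s}=0$ for $s>r\ge0$. *)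

theory Defs
  imports Complex_Main "Jordan_Normal_Form.Matrix"
begin

(* Matrix indices of the library start at 0.  The formulas are written in the
   1-based indices i = r + 1 and j = c + 1. *)

definition elevation_mat :: "nat \<Rightarrow> real mat" where
  "elevation_mat N = mat (N + 1) (N + 2) (\<lambda>(r, c).
     let i = r + 1; j = c + 1 in
       if i = j then (real N + 2 - real i) / (real N + 1)
       else if i + 1 = j then real i / (real N + 1)
       else 0)"

(* T_{n,m} = T_{n,n+1} T_{n+1,n+2} ... T_{m-1,m} for n < m.  The matrices have
   different sizes, so the product is a fold that starts from the identity
   matrix of size n + 1. *)
definition lifting_mat :: "nat \<Rightarrow> nat \<Rightarrow> real mat" where
  "lifting_mat n m = foldl (*) (1\<^sub>m (n + 1)) (map elevation_mat [n..<m])"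

end

theory Submission
  imports Defs
begin

text \<open>
  Induction on \<open>m\<close>. Column \<open>c\<close> (counted from 0) of an elevation matrix of level \<open>m\<close> has entries
  only in rows \<open>c - 1\<close> and \<open>c\<close>. Absorbing these entries into the denominators turns both
  \<open>1 / (m choose (c - 1))\<close> and \<open>1 / (m choose c)\<close> into \<open>1 / ((m + 1) choose c)\<close>, and Pascal's rule
  adds up the numerators.
\<close>

lemma elevation_mat_carrier: "elevation_mat N \<in> carrier_mat (N + 1) (N + 2)"
  by (simp add: elevation_mat_def)

text \<open>The two conditions exclude each other, so a sum can replace the nested conditional; a
  sum over rows then splits into two sums with one nonzero term each. On each diagonal the row is
  determined by the column, so the weights are written in \<open>c\<close> alone.\<close>

lemma elevation_mat_index:
  assumes "r \<le> N" "c \<le> N + 1"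
  shows "elevation_mat N $$ (r, c) =
    (if r = c then (real N + 1 - real c) / (real N + 1) else 0) +
    (if Suc r = c then real c / (real N + 1) else 0)"
  using assms by (auto simp: elevation_mat_def)

lemma lifting_mat_self: "lifting_mat n n = 1\<^sub>m (n + 1)"
  by (simp add: lifting_mat_def)

lemma lifting_mat_Suc:
  assumes "n \<le> m"
  shows "lifting_mat n (Suc m) = lifting_mat n m * elevation_mat m"
  using assms by (simp add: lifting_mat_def)

lemma lifting_mat_carrier:
  assumes "n \<le> m"
  shows "lifting_mat n m \<in> carrier_mat (n + 1) (m + 1)"
  using assms
proof (induction m rule: nat_induct_at_least)
  case base
  show ?case by (simp add: lifting_mat_self)
next
  case (Suc m)
  then show ?case
    using elevation_mat_carrier[of m] by (auto simp: lifting_mat_Suc)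
qed

text \<open>The guards mark the border columns: column \<open>N + 1\<close> has no diagonal entry,
  and column 0 has no superdiagonal entry.\<close>

lemma mult_elevation_mat_index:
  assumes A: "A \<in> carrier_mat k (N + 1)" and r: "r < k" and c: "c \<le> N + 1"
  shows "(A * elevation_mat N) $$ (r, c) =
    (if c \<le> N then A $$ (r, c) * ((real N + 1 - real c) / (real N + 1)) else 0) +
    (if c = 0 then 0 else A $$ (r, c - 1) * (real c / (real N + 1)))"
proof -
  have "(A * elevation_mat N) $$ (r, c) = (\<Sum>i<N + 1. A $$ (r, i) * elevation_mat N $$ (i, c))"
    using A r c elevation_mat_carrier[of N]
    by (auto simp: scalar_prod_def atLeast0LessThan intro!: sum.cong)
  also have "\<dots> = (\<Sum>i<N + 1.
      (if i = c then A $$ (r, i) * ((real N + 1 - real c) / (real N + 1)) else 0) +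
      (if Suc i = c then A $$ (r, i) * (real c / (real N + 1)) else 0))"
    using c by (intro sum.cong) (auto simp: elevation_mat_index)
  also have "\<dots> = (if c \<le> N then A $$ (r, c) * ((real N + 1 - real c) / (real N + 1)) else 0) +
    (if c = 0 then 0 else A $$ (r, c - 1) * (real c / (real N + 1)))"
    using c by (cases c) (auto simp: sum.distrib less_Suc_eq_le simp del: sum.lessThan_Suc)
  finally show ?thesis .
qed

text \<open>Reciprocal form of (m+1-c) * ((m+1) choose c) = (m+1) * (m choose c);
  \<open>c \<le> m\<close> makes both binomials nonzero, so division is safe.\<close>

lemma inverse_binomial_absorb_comp:
  assumes "c \<le> m"
  shows "1 / real (m choose c) * ((real m + 1 - real c) / (real m + 1)) = 1 / real (Suc m choose c)"
proof -
  have "real ((Suc m - c) * (Suc m choose c)) = real (Suc m * (m choose c))"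
    using binomial_absorb_comp[of "Suc m" c] by simp
  then have "(real m + 1 - real c) * real (Suc m choose c) = (real m + 1) * real (m choose c)"
    using assms by (simp only: of_nat_mult) (simp add: of_nat_diff algebra_simps)
  moreover have "real (m choose c) \<noteq> 0" "real (Suc m choose c) \<noteq> 0"
    using assms by (auto simp: binomial_eq_0_iff simp del: binomial_Suc_Suc)
  ultimately show ?thesis
    by (simp add: divide_simps del: binomial_Suc_Suc)
qed

lemma inverse_binomial_absorption:
  assumes "d \<le> m"
  shows "1 / real (m choose d) * (real (Suc d) / (real m + 1)) = 1 / real (Suc m choose Suc d)"
proof -
  have "real (Suc d * (Suc m choose Suc d)) = real (Suc m * (m choose d))"
    using binomial_absorption[of d "Suc m"] by (simp only: diff_Suc_1)
  then have "real (Suc d) * real (Suc m choose Suc d) = (real m + 1) * real (m choose d)"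
    by (simp only: of_nat_mult of_nat_Suc add.commute)
  moreover have "real (m choose d) \<noteq> 0" "real (Suc m choose Suc d) \<noteq> 0"
    using assms by (auto simp: binomial_eq_0_iff simp del: binomial_Suc_Suc)
  ultimately show ?thesis
    by (simp add: divide_simps del: binomial_Suc_Suc of_nat_Suc)
qed

lemma lifting_mat_index:
  assumes "n \<le> m" "r \<le> n" "c \<le> m"
  shows "lifting_mat n m $$ (r, c) =
    (if r \<le> c then real (n choose r) * real ((m - n) choose (c - r)) / real (m choose c) else 0)"
  using assms
\<comment> \<open>\<open>c\<close> must be arbitrary, since column \<open>c\<close> at the next
  level draws on columns \<open>c\<close> and \<open>c - 1\<close>.\<close>
proof (induction m arbitrary: c rule: nat_induct_at_least)
  case base
  then show ?case
    by (auto simp: lifting_mat_self binomial_eq_0_iff)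
next
  case (Suc m)
  let ?L = "\<lambda>c. lifting_mat n m $$ (r, c)"
  \<comment> \<open>The guard matters: below the diagonal the truncated difference
    \<open>c - r\<close> is 0 and the bare binomial would be 1.\<close>
  let ?B = "\<lambda>c. if r \<le> c then real ((m - n) choose (c - r)) else 0"
  have L: "?L c = real (n choose r) * ?B c * (1 / real (m choose c))" if "c \<le> m" for c
    using Suc.IH[OF Suc.prems(1) that] by simp
  have step: "lifting_mat n (Suc m) $$ (r, c) =
    (if c \<le> m then ?L c * ((real m + 1 - real c) / (real m + 1)) else 0) +
    (if c = 0 then 0 else ?L (c - 1) * (real c / (real m + 1)))"
    unfolding lifting_mat_Suc[OF Suc.hyps]
    using lifting_mat_carrier[OF Suc.hyps] Suc.prems
    by (intro mult_elevation_mat_index) auto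
  have same: "(if c \<le> m then ?L c * ((real m + 1 - real c) / (real m + 1)) else 0) =
    real (n choose r) * ?B c * (1 / real (Suc m choose c))"
  proof (cases "c \<le> m")
    case True
    then show ?thesis
      using inverse_binomial_absorb_comp[OF True] L[OF True] by (simp only: mult.assoc if_True)
  next
    case False
    \<comment> \<open>Here \<open>c\<close> is \<open>m + 1\<close>, and \<open>r \<le> n\<close>
      gives m+1-r > m-n, so \<open>?B c\<close> vanishes like the left side.\<close>
    then have "m - n < c - r" using Suc by auto
    with False show ?thesis by (simp add: binomial_eq_0)
  qed
  show ?case
  proof (cases c)
    case 0
    then show ?thesis using step same by simp
  next
    case (Suc d)
    have d: "d \<le> m" using Suc Suc.prems by simp
    have prev: "?L d * (real (Suc d) / (real m + 1)) =
        real (n choose r) * ?B d * (1 / real (Suc m choose Suc d))"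
      using inverse_binomial_absorption[OF d] L[OF d] by (simp only: mult.assoc)
    have pascal: "?B (Suc d) + ?B d =
        (if r \<le> Suc d then real ((Suc m - n) choose (Suc d - r)) else 0)"
    proof (cases "r \<le> d")
      case True
      then show ?thesis using \<open>n \<le> m\<close> by (simp add: Suc_diff_le)
    \<comment> \<open>Outside Pascal's rule remain r = d+1, where \<open>?B d\<close> is 0 and both
      other terms are 1, and r > d+1, where all terms are 0.\<close>
    qed (auto simp: le_Suc_eq)
    have "lifting_mat n (Suc m) $$ (r, c) =
        real (n choose r) * (?B (Suc d) + ?B d) * (1 / real (Suc m choose Suc d))"
      using step same prev unfolding Suc by (simp only: distrib_left distrib_right) simp
    then show ?thesis
      unfolding pascal Suc by simp
  qed
qed

theorem lemma5p1:
  fixes n m :: nat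
  assumes "n < m"
  shows "lifting_mat n m \<in> carrier_mat (n + 1) (m + 1)
    \<and> upper_triangular (lifting_mat n m)
    \<and> (\<forall>i \<in> {1..n + 1}. \<forall>j \<in> {1..m + 1}.
         lifting_mat n m $$ (i - 1, j - 1) =
           (if i \<le> j
            then real (n choose (i - 1)) * real ((m - n) choose (j - i)) / real (m choose (j - 1))
            else 0))"
proof (intro conjI ballI)
  have le: "n \<le> m" using assms by simp
  show carrier: "lifting_mat n m \<in> carrier_mat (n + 1) (m + 1)"
    by (rule lifting_mat_carrier[OF le])
  show "upper_triangular (lifting_mat n m)"
    \<comment> \<open>A column left of the diagonal in a row of index at most \<open>n\<close> has
      index below \<open>n\<close>, hence at most \<open>m\<close>, so the entry formula applies
      there.\<close>
    using carrier le by (auto simp: upper_triangular_def lifting_mat_index)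
  fix i j
  assume "i \<in> {1..n + 1}" "j \<in> {1..m + 1}"
  then show "lifting_mat n m $$ (i - 1, j - 1) =
      (if i \<le> j
       then real (n choose (i - 1)) * real ((m - n) choose (j - i)) / real (m choose (j - 1))
       else 0)"
    using lifting_mat_index[OF le, of "i - 1" "j - 1"] by (auto simp: le_diff_conv)
qed

end
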